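(* Nontrivial finitely generated projective Wajsberg hoops are unbounded; that is, if $\mathbf A$ is a finitely generated Wajsberg hoop with more than one element that is projective in the variety of Wajsberg hoops, then $\mathbf A$ has no least element.
   Context: A Wajsberg hoop is an algebra $(A,\cdot,\to,1)$ with $(A,\cdot,1)$ a commutative monoid satisfying $x\to x=1$, $x\cdot(x\to y)=y\cdot(y\to x)$, $(x\cdot y)\to z=x\to(y\to z)$, and $(x\to y)\to y=(y\to x)\to x$. It is lattice-ordered by $x\le y$ iff $x\to y=1$, with top element $1$; it is bounded if it has a least element in this order, and unbounded otherwise. The variety of Wajsberg hoops is $\mathsf{WH}$. $\mathbf P\in\mathsf{WH}$ is projective in $\mathsf{WH}$ if for all $\mathbf A,\mathbf B\in\mathsf{WH}$, every homomorphism $f:\mathbf P\to\mathbf A$ and every surjective homomorphism $g:\mathbf B\to\mathbf A$, there is a homomorphism $h:\mathbf P\to\mathbf B$ with $f=g\circ h$. *)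

theory Defs
  imports "HOL-Algebra.Group" "HOL-Library.Infinite_Typeclass" "HOL-Library.Countable_Set"
begin

record 'a hoop = "'a monoid" +
  imp :: "'a \<Rightarrow> 'a \<Rightarrow> 'a" (infixr \<open>\<leadsto>\<index>\<close> 60)

locale wajsberg_hoop = comm_monoid A for A (structure) +
  assumes imp_closed [intro, simp]:
      "\<lbrakk>x \<in> carrier A; y \<in> carrier A\<rbrakk> \<Longrightarrow> (x \<leadsto> y) \<in> carrier A"
    and imp_refl: "x \<in> carrier A \<Longrightarrow> (x \<leadsto> x) = \<one>"
    and divisibility:
      "\<lbrakk>x \<in> carrier A; y \<in> carrier A\<rbrakk> \<Longrightarrow> x \<otimes> (x \<leadsto> y) = y \<otimes> (y \<leadsto> x)"
    and residuation:
      "\<lbrakk>x \<in> carrier A; y \<in> carrier A; z \<in> carrier A\<rbrakk>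
        \<Longrightarrow> ((x \<otimes> y) \<leadsto> z) = (x \<leadsto> (y \<leadsto> z))"
    and wajsberg:
      "\<lbrakk>x \<in> carrier A; y \<in> carrier A\<rbrakk>
        \<Longrightarrow> ((x \<leadsto> y) \<leadsto> y) = ((y \<leadsto> x) \<leadsto> x)"

definition hoop_le :: "('a, 'm) hoop_scheme \<Rightarrow> 'a \<Rightarrow> 'a \<Rightarrow> bool" where
  "hoop_le A x y \<longleftrightarrow> (x \<leadsto>\<^bsub>A\<^esub> y) = \<one>\<^bsub>A\<^esub>"

definition bounded_hoop :: "('a, 'm) hoop_scheme \<Rightarrow> bool" where
  "bounded_hoop A \<longleftrightarrow> (\<exists>m \<in> carrier A. \<forall>x \<in> carrier A. hoop_le A m x)"

definition hoop_hom :: "('a, 'm) hoop_scheme \<Rightarrow> ('b, 'n) hoop_scheme \<Rightarrow> ('a \<Rightarrow> 'b) set" where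
  "hoop_hom A B = {h \<in> hom A B. h \<one>\<^bsub>A\<^esub> = \<one>\<^bsub>B\<^esub> \<and>
     (\<forall>x \<in> carrier A. \<forall>y \<in> carrier A. h (x \<leadsto>\<^bsub>A\<^esub> y) = (h x \<leadsto>\<^bsub>B\<^esub> h y))}"

inductive_set hoop_generate :: "('a, 'm) hoop_scheme \<Rightarrow> 'a set \<Rightarrow> 'a set"
  for A (structure) and G where
  one: "\<one> \<in> hoop_generate A G"
| incl: "x \<in> G \<Longrightarrow> x \<in> hoop_generate A G"
| mult: "\<lbrakk>x \<in> hoop_generate A G; y \<in> hoop_generate A G\<rbrakk> \<Longrightarrow> x \<otimes> y \<in> hoop_generate A G"
| imp: "\<lbrakk>x \<in> hoop_generate A G; y \<in> hoop_generate A G\<rbrakk> \<Longrightarrow> (x \<leadsto> y) \<in> hoop_generate A G"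

definition finitely_generated_hoop :: "('a, 'm) hoop_scheme \<Rightarrow> bool" where
  "finitely_generated_hoop A \<longleftrightarrow>
     (\<exists>G. finite G \<and> G \<subseteq> carrier A \<and> hoop_generate A G = carrier A)"

text \<open>
  A definition in HOL cannot quantify over all types, so the types in which the test
  hoops \<open>A\<close> and \<open>B\<close> of the lifting property live are parameters. Within
  these types \<open>A\<close> and \<open>B\<close> have arbitrary carriers. For finitely generated
  \<open>P\<close> nothing is lost as soon as the two types are infinite: the theorem
  \<open>projective_hoop_universal\<close> below shows that the lifting property then holds with
  respect to Wajsberg hoops over any types.
\<close>

definition projective_hoop ::
    "'b::infinite itself \<Rightarrow> 'c::infinite itself \<Rightarrow> ('a, 'm) hoop_scheme \<Rightarrow> bool" where
  "projective_hoop _ _ P \<longleftrightarrow>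
     (\<forall>(A :: 'b hoop) (B :: 'c hoop) f g.
        wajsberg_hoop A \<longrightarrow> wajsberg_hoop B \<longrightarrow>
        f \<in> hoop_hom P A \<longrightarrow> g \<in> hoop_hom B A \<longrightarrow> g ` carrier B = carrier A \<longrightarrow>
        (\<exists>h \<in> hoop_hom P B. \<forall>x \<in> carrier P. f x = g (h x)))"

lemma hoop_homI:
  assumes "\<And>x. x \<in> carrier A \<Longrightarrow> h x \<in> carrier B"
    and "\<And>x y. \<lbrakk>x \<in> carrier A; y \<in> carrier A\<rbrakk> \<Longrightarrow> h (x \<otimes>\<^bsub>A\<^esub> y) = h x \<otimes>\<^bsub>B\<^esub> h y"
    and "h \<one>\<^bsub>A\<^esub> = \<one>\<^bsub>B\<^esub>"
    and "\<And>x y. \<lbrakk>x \<in> carrier A; y \<in> carrier A\<rbrakk> \<Longrightarrow> h (x \<leadsto>\<^bsub>A\<^esub> y) = (h x \<leadsto>\<^bsub>B\<^esub> h y)"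
  shows "h \<in> hoop_hom A B"
  using assms unfolding hoop_hom_def hom_def by auto

lemma hoop_homD:
  assumes "h \<in> hoop_hom A B"
  shows "\<And>x. x \<in> carrier A \<Longrightarrow> h x \<in> carrier B"
    and "\<And>x y. \<lbrakk>x \<in> carrier A; y \<in> carrier A\<rbrakk> \<Longrightarrow> h (x \<otimes>\<^bsub>A\<^esub> y) = h x \<otimes>\<^bsub>B\<^esub> h y"
    and "h \<one>\<^bsub>A\<^esub> = \<one>\<^bsub>B\<^esub>"
    and "\<And>x y. \<lbrakk>x \<in> carrier A; y \<in> carrier A\<rbrakk> \<Longrightarrow> h (x \<leadsto>\<^bsub>A\<^esub> y) = (h x \<leadsto>\<^bsub>B\<^esub> h y)"
  using assms unfolding hoop_hom_def hom_def by auto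

lemma (in wajsberg_hoop) hoop_generate_subset:
  assumes "G \<subseteq> carrier A"
  shows "hoop_generate A G \<subseteq> carrier A"
proof
  fix x assume "x \<in> hoop_generate A G"
  then show "x \<in> carrier A"
    by induction (use assms in auto)
qed

lemma countable_hoop_generate:
  assumes "countable G"
  shows "countable (hoop_generate A G)"
proof -
  define W where "W = rec_nat (insert \<one>\<^bsub>A\<^esub> G)
    (\<lambda>_ X. X \<union> (\<lambda>(x, y). x \<otimes>\<^bsub>A\<^esub> y) ` (X \<times> X) \<union> (\<lambda>(x, y). x \<leadsto>\<^bsub>A\<^esub> y) ` (X \<times> X))"
  have W0: "W 0 = insert \<one>\<^bsub>A\<^esub> G" by (simp add: W_def)
  have WS: "W (Suc n) = W n \<union> (\<lambda>(x, y). x \<otimes>\<^bsub>A\<^esub> y) ` (W n \<times> W n) \<union>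
      (\<lambda>(x, y). x \<leadsto>\<^bsub>A\<^esub> y) ` (W n \<times> W n)" for n by (simp add: W_def)
  have cW: "countable (W n)" for n
    by (induction n) (use assms in \<open>auto simp: W0 WS\<close>)
  have mono: "W m \<subseteq> W n" if "m \<le> n" for m n
    using that by (rule lift_Suc_mono_le[rotated]) (auto simp: WS)
  have "x \<in> (\<Union>n. W n)" if "x \<in> hoop_generate A G" for x
    using that
  proof induction
    case one
    then show ?case using W0 by blast
  next
    case (incl x)
    then show ?case using W0 by blast
  next
    case (mult x y)
    then obtain m n where "x \<in> W m" "y \<in> W n" by blast
    then have "x \<in> W (max m n)" "y \<in> W (max m n)" using mono by (meson max.cobounded1 max.cobounded2 subsetD)+
    then have "x \<otimes>\<^bsub>A\<^esub> y \<in> W (Suc (max m n))" by (auto simp: WS)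
    then show ?case by blast
  next
    case (imp x y)
    then obtain m n where "x \<in> W m" "y \<in> W n" by blast
    then have "x \<in> W (max m n)" "y \<in> W (max m n)" using mono by (meson max.cobounded1 max.cobounded2 subsetD)+
    then have "(x \<leadsto>\<^bsub>A\<^esub> y) \<in> W (Suc (max m n))" by (auto simp: WS)
    then show ?case by blast
  qed
  then have "hoop_generate A G \<subseteq> (\<Union>n. W n)" by blast
  moreover have "countable (\<Union>n. W n)" using cW by simp
  ultimately show ?thesis by (rule countable_subset)
qed

text \<open>The copy of the subhoop \<open>S\<close> of \<open>A\<close> along an injection \<open>\<phi>\<close> of \<open>S\<close> into another type.\<close>

definition transport_hoop :: "('a \<Rightarrow> 'b) \<Rightarrow> 'a set \<Rightarrow> ('a, 'm) hoop_scheme \<Rightarrow> 'b hoop" where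
  "transport_hoop \<phi> S A = \<lparr>carrier = \<phi> ` S,
     mult = (\<lambda>x y. \<phi> (inv_into S \<phi> x \<otimes>\<^bsub>A\<^esub> inv_into S \<phi> y)), one = \<phi> \<one>\<^bsub>A\<^esub>,
     imp = (\<lambda>x y. \<phi> (inv_into S \<phi> x \<leadsto>\<^bsub>A\<^esub> inv_into S \<phi> y))\<rparr>"

locale hoop_transport = wajsberg_hoop A for A :: "('a, 'm) hoop_scheme" (structure) +
  fixes S :: "'a set" and \<phi> :: "'a \<Rightarrow> 'b"
  assumes sub: "S \<subseteq> carrier A" and one_S: "\<one> \<in> S"
    and mult_S: "\<lbrakk>x \<in> S; y \<in> S\<rbrakk> \<Longrightarrow> x \<otimes> y \<in> S"
    and imp_S: "\<lbrakk>x \<in> S; y \<in> S\<rbrakk> \<Longrightarrow> (x \<leadsto> y) \<in> S"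
    and inj: "inj_on \<phi> S"
begin

abbreviation "T \<equiv> transport_hoop \<phi> S A"

lemma T_simps [simp]:
  "carrier T = \<phi> ` S" "\<one>\<^bsub>T\<^esub> = \<phi> \<one>"
  "\<lbrakk>x \<in> S; y \<in> S\<rbrakk> \<Longrightarrow> \<phi> x \<otimes>\<^bsub>T\<^esub> \<phi> y = \<phi> (x \<otimes> y)"
  "\<lbrakk>x \<in> S; y \<in> S\<rbrakk> \<Longrightarrow> (\<phi> x \<leadsto>\<^bsub>T\<^esub> \<phi> y) = \<phi> (x \<leadsto> y)"
  using inj by (simp_all add: transport_hoop_def)

lemma wajsberg_T: "wajsberg_hoop T"
proof -
  have S: "x \<in> carrier A" if "x \<in> S" for x using sub that by blast
  note [simp] = S one_S mult_S imp_S
  have "comm_monoid T"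
    by (rule comm_monoidI) (auto simp: m_assoc, simp add: m_comm)
  moreover have "wajsberg_hoop_axioms T"
  proof
    fix u v assume "u \<in> carrier T" "v \<in> carrier T"
    then obtain x y where xy [simp]: "x \<in> S" "u = \<phi> x" "y \<in> S" "v = \<phi> y" by auto
    show "(u \<leadsto>\<^bsub>T\<^esub> v) \<in> carrier T" by simp
    show "(u \<leadsto>\<^bsub>T\<^esub> u) = \<one>\<^bsub>T\<^esub>" by (simp add: imp_refl)
    show "u \<otimes>\<^bsub>T\<^esub> (u \<leadsto>\<^bsub>T\<^esub> v) = v \<otimes>\<^bsub>T\<^esub> (v \<leadsto>\<^bsub>T\<^esub> u)"
      using divisibility[of x y] by simp
    show "((u \<leadsto>\<^bsub>T\<^esub> v) \<leadsto>\<^bsub>T\<^esub> v) = ((v \<leadsto>\<^bsub>T\<^esub> u) \<leadsto>\<^bsub>T\<^esub> u)"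
      using wajsberg[of x y] by simp
    fix w assume "w \<in> carrier T"
    then obtain z where [simp]: "z \<in> S" "w = \<phi> z" by auto
    show "((u \<otimes>\<^bsub>T\<^esub> v) \<leadsto>\<^bsub>T\<^esub> w) = (u \<leadsto>\<^bsub>T\<^esub> (v \<leadsto>\<^bsub>T\<^esub> w))"
      by (simp add: residuation)
  qed
  ultimately show ?thesis by (rule wajsberg_hoop.intro)
qed

end

theorem projective_hoop_universal:
  fixes P :: "('a, 'm) hoop_scheme" and A :: "('d, 'k) hoop_scheme" and B :: "('e, 'l) hoop_scheme"
  assumes P: "wajsberg_hoop P" and fg: "finitely_generated_hoop P"
    and proj: "projective_hoop TYPE('b::infinite) TYPE('c::infinite) P"
    and A: "wajsberg_hoop A" and B: "wajsberg_hoop B"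
    and f: "f \<in> hoop_hom P A" and g: "g \<in> hoop_hom B A" and surj: "g ` carrier B = carrier A"
  shows "\<exists>h \<in> hoop_hom P B. \<forall>x \<in> carrier P. f x = g (h x)"
proof -
  obtain G where G: "finite G" "G \<subseteq> carrier P" "hoop_generate P G = carrier P"
    using fg unfolding finitely_generated_hoop_def by blast
  have "\<forall>x \<in> G. \<exists>y \<in> carrier B. g y = f x"
    using surj G hoop_homD(1)[OF f] by (metis imageE subsetD)
  then obtain b where b: "\<And>x. x \<in> G \<Longrightarrow> b x \<in> carrier B \<and> g (b x) = f x" by metis
  define S where "S = hoop_generate B (b ` G)"
  have Ssub: "S \<subseteq> carrier B"
    unfolding S_def using b by (intro wajsberg_hoop.hoop_generate_subset[OF B]) auto
  have S: "\<one>\<^bsub>B\<^esub> \<in> S" "\<And>x y. \<lbrakk>x \<in> S; y \<in> S\<rbrakk> \<Longrightarrow> x \<otimes>\<^bsub>B\<^esub> y \<in> S"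
    "\<And>x y. \<lbrakk>x \<in> S; y \<in> S\<rbrakk> \<Longrightarrow> (x \<leadsto>\<^bsub>B\<^esub> y) \<in> S"
    unfolding S_def by (auto intro: hoop_generate.intros)
  have cS: "countable S"
    unfolding S_def using G(1) by (intro countable_hoop_generate countable_finite) auto
  note gD = hoop_homD[OF g] and fD = hoop_homD[OF f]
  have SB: "x \<in> carrier B" if "x \<in> S" for x using Ssub that by blast
  define R where "R = g ` S"
  have R: "R \<subseteq> carrier A" "\<one>\<^bsub>A\<^esub> \<in> R" "\<And>x y. \<lbrakk>x \<in> R; y \<in> R\<rbrakk> \<Longrightarrow> x \<otimes>\<^bsub>A\<^esub> y \<in> R"
    "\<And>x y. \<lbrakk>x \<in> R; y \<in> R\<rbrakk> \<Longrightarrow> (x \<leadsto>\<^bsub>A\<^esub> y) \<in> R"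
  proof -
    show "R \<subseteq> carrier A" unfolding R_def using gD(1) SB by auto
    show "\<one>\<^bsub>A\<^esub> \<in> R" unfolding R_def using gD(3) S(1) by (metis imageI)
    show "x \<otimes>\<^bsub>A\<^esub> y \<in> R" if "x \<in> R" "y \<in> R" for x y
      using that S(2) SB unfolding R_def by (auto simp: gD(2)[symmetric])
    show "(x \<leadsto>\<^bsub>A\<^esub> y) \<in> R" if "x \<in> R" "y \<in> R" for x y
      using that S(3) SB unfolding R_def by (auto simp: gD(4)[symmetric])
  qed
  have cR: "countable R" unfolding R_def using cS by simp
  have fR: "f x \<in> R" if "x \<in> carrier P" for x
  proof -
    have "x \<in> hoop_generate P G" using that G by simp
    then show ?thesis
    proof induction
      case one
      then show ?case using fD(3) R(2) by simp
    next
      case (incl x)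
      then show ?case using b[of x] unfolding R_def S_def
        by (metis hoop_generate.incl imageI)
    next
      case (mult x y)
      then show ?case using fD(2) R(3) G(3) by simp
    next
      case (imp x y)
      then show ?case using fD(4) R(4) G(3) by simp
    qed
  qed
  obtain \<iota> :: "nat \<Rightarrow> 'b" where \<iota>: "inj \<iota>"
    using infinite_UNIV infinite_countable_subset by blast
  obtain \<kappa> :: "nat \<Rightarrow> 'c" where \<kappa>: "inj \<kappa>"
    using infinite_UNIV infinite_countable_subset by blast
  define \<psi> where "\<psi> = \<iota> \<circ> to_nat_on R"
  define \<phi> where "\<phi> = \<kappa> \<circ> to_nat_on S"
  have \<psi>: "inj_on \<psi> R" unfolding \<psi>_def
    using cR \<iota> by (intro comp_inj_on inj_on_to_nat_on) (auto intro: inj_on_subset)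
  have \<phi>: "inj_on \<phi> S" unfolding \<phi>_def
    using cS \<kappa> by (intro comp_inj_on inj_on_to_nat_on) (auto intro: inj_on_subset)
  interpret TA: hoop_transport A R \<psi>
    using A R \<psi> by (simp add: hoop_transport_def hoop_transport_axioms_def)
  interpret TB: hoop_transport B S \<phi>
    using B Ssub S \<phi> by (simp add: hoop_transport_def hoop_transport_axioms_def)
  interpret P: wajsberg_hoop P by (rule P)
  define f' where "f' = \<psi> \<circ> f"
  define g' where "g' = \<psi> \<circ> g \<circ> inv_into S \<phi>"
  have f': "f' \<in> hoop_hom P TA.T"
    by (rule hoop_homI) (auto simp: f'_def fR fD)
  have g\<phi>: "g' (\<phi> x) = \<psi> (g x)" if "x \<in> S" for x
    using that \<phi> by (simp add: g'_def)
  have gR: "g x \<in> R" if "x \<in> S" for x using that by (simp add: R_def)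
  have g': "g' \<in> hoop_hom TB.T TA.T"
    by (rule hoop_homI) (auto simp: g\<phi> gR S gD SB)
  have surj': "g' ` carrier TB.T = carrier TA.T"
    by (simp add: g\<phi> image_image) (simp add: R_def image_image)
  obtain h' where h': "h' \<in> hoop_hom P TB.T" "\<And>x. x \<in> carrier P \<Longrightarrow> f' x = g' (h' x)"
    using proj[unfolded projective_hoop_def, rule_format,
      OF TA.wajsberg_T TB.wajsberg_T f' g' surj'] by blast
  note hD = hoop_homD[OF h'(1)]
  define h where "h = inv_into S \<phi> \<circ> h'"
  have hS: "h x \<in> S" "h' x = \<phi> (h x)" if "x \<in> carrier P" for x
    using hD(1)[OF that] by (auto simp: h_def inv_into_into f_inv_into_f)
  have inv: "inv_into S \<phi> (\<phi> x) = x" if "x \<in> S" for x using \<phi> that by simp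
  have "h \<in> hoop_hom P B"
  proof (rule hoop_homI)
    fix x y assume xy: "x \<in> carrier P" "y \<in> carrier P"
    show "h (x \<otimes>\<^bsub>P\<^esub> y) = h x \<otimes>\<^bsub>B\<^esub> h y"
    proof -
      have "h' (x \<otimes>\<^bsub>P\<^esub> y) = \<phi> (h x \<otimes>\<^bsub>B\<^esub> h y)"
        using hD(2)[OF xy] xy by (simp add: hS)
      then show ?thesis using xy by (simp add: h_def inv S hS(1)[unfolded h_def, simplified])
    qed
    show "h (x \<leadsto>\<^bsub>P\<^esub> y) = (h x \<leadsto>\<^bsub>B\<^esub> h y)"
    proof -
      have "h' (x \<leadsto>\<^bsub>P\<^esub> y) = \<phi> (h x \<leadsto>\<^bsub>B\<^esub> h y)"
        using hD(4)[OF xy] xy by (simp add: hS)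
      then show ?thesis using xy by (simp add: h_def inv S hS(1)[unfolded h_def, simplified])
    qed
  next
    show "h \<one>\<^bsub>P\<^esub> = \<one>\<^bsub>B\<^esub>" using hD(3) by (simp add: h_def S inv)
  qed (use hS SB in auto)
  moreover have "f x = g (h x)" if "x \<in> carrier P" for x
  proof -
    have "\<psi> (f x) = \<psi> (g (h x))"
      using h'(2)[OF that] hS[OF that] g\<phi> by (simp add: f'_def)
    then show ?thesis
      using \<psi> fR[OF that] gR[OF hS(1)[OF that]] by (meson inj_onD)
  qed
  ultimately show ?thesis by blast
qed

end

theory Submission
  imports Defs "HOL-Complex_Analysis.Great_Picard"
begin

text \<open>
  The least element \<open>m\<close> of a bounded hoop \<open>A\<close> is idempotent. By a Hoelder-type argument a nontrivial
  bounded \<open>A\<close> has a homomorphism \<open>f\<close> to the standard hoop on the unit interval sending \<open>m\<close> to the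
  least element. That hoop is the image, under evaluation at \<open>1\<close>, of the hoop of continuous
  functions into the interval that take the top value at \<open>0\<close>. If \<open>A\<close> is projective, then \<open>f\<close> lifts
  and \<open>m\<close> goes to an idempotent function; an idempotent takes only the two extreme values, so by
  continuity it is constantly the top, although its value at \<open>1\<close> is the least element.

  For the homomorphism, take a maximal filter \<open>F\<close> omitting \<open>m\<close>; it induces a total archimedean
  preorder \<open>x \<rightarrow> y \<in> F\<close>. For \<open>c \<notin> F\<close> let \<open>L c x\<close> be the least \<open>n\<close> with \<open>c\<^sup>n\<close> below \<open>x\<close>. Up to an error
  of order \<open>1 / L c m\<close>, the map \<open>x \<mapsto> 1 - L c x / L c m\<close> is a homomorphism. Either \<open>c\<close> can be chosen
  with no error at all (a coatom), or with \<open>L c m\<close> arbitrarily large, and then a limit along a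
  subsequence is a homomorphism.
\<close>

section \<open>Arithmetic of Wajsberg hoops\<close>

context wajsberg_hoop
begin

text \<open>With \<open>t = x \<leadsto> \<one>\<close>, divisibility gives
  \<open>\<one> \<leadsto> x = x \<otimes> t\<close>. As \<open>x\<close> lies below this,
  divisibility also writes \<open>x\<close> as
  \<open>(x \<otimes> t) \<otimes> (t \<leadsto> \<one>)\<close>, and \<open>t\<close> absorbs
  \<open>t \<leadsto> \<one>\<close>.\<close>

lemma one_imp: assumes x: "x \<in> carrier A" shows "\<one> \<leadsto> x = x"
proof -
  define t where "t = x \<leadsto> \<one>"
  have t: "t \<in> carrier A" using x by (simp add: t_def)
  have "\<one> \<leadsto> t = t"
    using residuation[of \<one> x \<one>] residuation[of x \<one> \<one>] x by (simp add: t_def imp_refl)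
  then have tt: "t \<otimes> (t \<leadsto> \<one>) = t" using divisibility[of t \<one>] t by simp
  have y: "\<one> \<leadsto> x = x \<otimes> t" using divisibility[of x \<one>] x by (simp add: t_def)
  have "x \<leadsto> (\<one> \<leadsto> x) = \<one>" using residuation[of x \<one> x] x by (simp add: imp_refl)
  then have "x = (x \<otimes> t) \<otimes> ((x \<otimes> t) \<leadsto> x)" using divisibility[of x "x \<otimes> t"] x t y by simp
  also have "(x \<otimes> t) \<leadsto> x = t \<leadsto> \<one>"
    using residuation[of t x x] x t by (simp add: imp_refl m_comm)
  also have "(x \<otimes> t) \<otimes> (t \<leadsto> \<one>) = x \<otimes> t" using x t tt by (simp add: m_assoc)
  finally show ?thesis using y by simp
qed

lemma imp_one: assumes x: "x \<in> carrier A" shows "x \<leadsto> \<one> = \<one>"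
proof -
  define t where "t = x \<leadsto> \<one>"
  have t: "t \<in> carrier A" using x by (simp add: t_def)
  have "x \<otimes> t = x" using divisibility[of x \<one>] x one_imp by (simp add: t_def)
  then have "t = (t \<otimes> x) \<leadsto> \<one>" using x t by (simp add: t_def m_comm)
  also have "\<dots> = \<one>" using residuation[of t x \<one>] x t by (simp add: imp_refl flip: t_def)
  finally show ?thesis by (simp add: t_def)
qed

lemma mult_imp_left:
  assumes "x \<in> carrier A" "y \<in> carrier A" shows "(x \<otimes> y) \<leadsto> x = \<one>"
  using residuation[of y x x] assms by (simp add: m_comm imp_refl imp_one)

lemma imp_weaken:
  assumes "x \<in> carrier A" "y \<in> carrier A" shows "x \<leadsto> (y \<leadsto> x) = \<one>"
  using residuation[of x y x] mult_imp_left assms by simp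

text \<open>Residuation collects the premises into one product, and two uses of divisibility expose
  \<open>z\<close> as a factor of it.\<close>

lemma imp_trans:
  assumes "x \<in> carrier A" "y \<in> carrier A" "z \<in> carrier A"
  shows "(x \<leadsto> y) \<leadsto> ((y \<leadsto> z) \<leadsto> (x \<leadsto> z)) = \<one>"
proof -
  have "(x \<leadsto> y) \<leadsto> ((y \<leadsto> z) \<leadsto> (x \<leadsto> z)) = ((x \<leadsto> y) \<otimes> (y \<leadsto> z) \<otimes> x) \<leadsto> z"
    using assms by (simp add: residuation)
  also have "(x \<leadsto> y) \<otimes> (y \<leadsto> z) \<otimes> x = x \<otimes> (x \<leadsto> y) \<otimes> (y \<leadsto> z)"
    using assms by (simp add: m_ac)
  also have "\<dots> = y \<otimes> (y \<leadsto> x) \<otimes> (y \<leadsto> z)" using assms by (simp add: divisibility)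
  also have "\<dots> = y \<otimes> (y \<leadsto> z) \<otimes> (y \<leadsto> x)" using assms by (simp add: m_ac)
  also have "\<dots> = z \<otimes> ((z \<leadsto> y) \<otimes> (y \<leadsto> x))" using assms divisibility[of y z] by (simp add: m_assoc)
  finally show ?thesis using assms by (simp add: mult_imp_left)
qed

lemma mult_mono_imp:
  assumes "x \<in> carrier A" "y \<in> carrier A" "z \<in> carrier A"
  shows "(x \<leadsto> y) \<leadsto> ((x \<otimes> z) \<leadsto> (y \<otimes> z)) = \<one>"
proof -
  have "(x \<leadsto> y) \<leadsto> ((x \<otimes> z) \<leadsto> (y \<otimes> z)) = ((x \<leadsto> y) \<otimes> (x \<otimes> z)) \<leadsto> (y \<otimes> z)"
    using assms by (simp add: residuation)
  also have "(x \<leadsto> y) \<otimes> (x \<otimes> z) = x \<otimes> (x \<leadsto> y) \<otimes> z" using assms by (simp add: m_ac)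
  also have "\<dots> = y \<otimes> (y \<leadsto> x) \<otimes> z" using assms divisibility[of x y] by simp
  also have "\<dots> = y \<otimes> z \<otimes> (y \<leadsto> x)" using assms by (simp add: m_ac)
  finally show ?thesis using assms by (simp add: mult_imp_left)
qed

lemma imp_imp_imp:
  assumes "x \<in> carrier A" "y \<in> carrier A"
  shows "((x \<leadsto> y) \<leadsto> y) \<leadsto> y = x \<leadsto> y"
  using wajsberg[of "x \<leadsto> y" y] assms by (simp add: imp_weaken one_imp)

text \<open>The identity behind prelinearity. Once \<open>y \<leadsto> x\<close> is written as
  \<open>(?p \<leadsto> y) \<leadsto> x\<close>, residuation gathers
  \<open>?p \<otimes> (?p \<leadsto> y)\<close>, the meet of \<open>?p\<close> and \<open>y\<close>,
  which is \<open>y\<close> because \<open>y\<close> lies below \<open>?p\<close>.\<close>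

lemma imp_swap_absorb:
  assumes x: "x \<in> carrier A" and y: "y \<in> carrier A"
  shows "(x \<leadsto> y) \<leadsto> (y \<leadsto> x) = y \<leadsto> x"
proof -
  let ?p = "x \<leadsto> y"
  have q: "y \<leadsto> x = (?p \<leadsto> y) \<leadsto> x" using imp_imp_imp[OF y x] wajsberg[OF x y] by simp
  have "?p \<leadsto> (y \<leadsto> x) = (?p \<otimes> (?p \<leadsto> y)) \<leadsto> x" using x y by (simp add: q residuation)
  also have "?p \<otimes> (?p \<leadsto> y) = y \<otimes> (y \<leadsto> ?p)" using x y by (simp add: divisibility)
  also have "\<dots> = y" using x y by (simp add: imp_weaken)
  finally show ?thesis .
qed

lemma least_idem:
  assumes m: "m \<in> carrier A" and least: "\<And>x. x \<in> carrier A \<Longrightarrow> m \<leadsto> x = \<one>"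
  shows "m \<otimes> m = m"
  using divisibility[of m "m \<otimes> m"] m least[of "m \<otimes> m"] mult_imp_left[of m m] by simp

end

section \<open>Filters and the preorders they induce\<close>

locale hoop_filter = wajsberg_hoop A for A (structure) +
  fixes F
  assumes F_sub: "F \<subseteq> carrier A" and one_F: "\<one> \<in> F"
    and mp: "\<lbrakk>x \<in> F; x \<leadsto> y \<in> F; y \<in> carrier A\<rbrakk> \<Longrightarrow> y \<in> F"
begin

abbreviation fle (infix "\<preceq>" 50) where "x \<preceq> y \<equiv> (x \<leadsto> y) \<in> F"

lemma fle_refl: "x \<in> carrier A \<Longrightarrow> x \<preceq> x"
  by (simp add: imp_refl one_F)

lemma fle_trans:
  assumes "x \<preceq> y" "y \<preceq> z" "x \<in> carrier A" "y \<in> carrier A" "z \<in> carrier A"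
  shows "x \<preceq> z"
proof -
  have "(y \<leadsto> z) \<leadsto> (x \<leadsto> z) \<in> F"
    using mp[OF assms(1)] imp_trans[of x y z] assms one_F by simp
  then show ?thesis using mp[OF assms(2)] assms by simp
qed

lemma fle_mult_right:
  assumes "x \<preceq> y" "x \<in> carrier A" "y \<in> carrier A" "z \<in> carrier A"
  shows "x \<otimes> z \<preceq> y \<otimes> z"
  using mp[OF assms(1)] mult_mono_imp[of x y z] assms one_F by simp

lemma fle_mult:
  assumes "x \<preceq> y" "u \<preceq> v" "x \<in> carrier A" "y \<in> carrier A" "u \<in> carrier A" "v \<in> carrier A"
  shows "x \<otimes> u \<preceq> y \<otimes> v"
proof (rule fle_trans)
  show "x \<otimes> u \<preceq> y \<otimes> u" using fle_mult_right assms by simp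
  show "y \<otimes> u \<preceq> y \<otimes> v" using fle_mult_right[of u v y] assms by (simp add: m_comm)
qed (use assms in auto)

lemma mult_fle_left:
  assumes "x \<in> carrier A" "y \<in> carrier A"
  shows "x \<otimes> y \<preceq> x"
  using assms by (simp add: mult_imp_left one_F)

text \<open>The right-hand side is the meet of \<open>x\<close> and \<open>y\<close>; divisibility
  turns it into \<open>x \<otimes> (x \<leadsto> y)\<close>, where residuation applies.\<close>

lemma fle_meet:
  assumes "x \<preceq> y" "x \<in> carrier A" "y \<in> carrier A"
  shows "x \<preceq> y \<otimes> (y \<leadsto> x)"
proof -
  have "(x \<leadsto> y) \<leadsto> (x \<leadsto> (x \<otimes> (x \<leadsto> y))) = \<one>"
    using assms residuation[of "x \<leadsto> y" x "x \<otimes> (x \<leadsto> y)"] by (simp add: m_comm imp_refl)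
  then have "x \<preceq> x \<otimes> (x \<leadsto> y)" using mp[OF assms(1)] assms one_F by simp
  then show ?thesis using divisibility assms by simp
qed

lemma fle_pow_mono:
  assumes "x \<preceq> y" "x \<in> carrier A" "y \<in> carrier A"
  shows "x [^] (n::nat) \<preceq> y [^] n"
proof (induction n)
  case 0
  show ?case by (simp add: imp_refl one_F)
next
  case (Suc n)
  then show ?case using fle_mult assms by simp
qed

lemma fle_pow_anti:
  assumes "c \<in> carrier A" "i \<le> (j::nat)"
  shows "c [^] j \<preceq> c [^] i"
  using mult_fle_left[of "c [^] i" "c [^] (j - i)"] assms by (simp add: nat_pow_mult)

text \<open>The join of \<open>x \<leadsto> y\<close> and \<open>y \<leadsto> x\<close> is the top
  modulo \<open>F\<close>. Transitivity and \<open>imp_swap_absorb\<close> turn \<open>p\<close>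
  into \<open>(z \<leadsto> ?q) \<leadsto> ?q\<close>; the Wajsberg identity swaps \<open>z\<close>
  and \<open>?q\<close>, and \<open>q\<close> detaches \<open>z\<close>.\<close>

lemma prelinear:
  assumes xyz: "x \<in> carrier A" "y \<in> carrier A" "z \<in> carrier A"
    and p: "(x \<leadsto> y) \<preceq> z" and q: "(y \<leadsto> x) \<preceq> z"
  shows "z \<in> F"
proof -
  let ?p = "x \<leadsto> y" and ?q = "y \<leadsto> x"
  have "(?p \<leadsto> z) \<leadsto> ((z \<leadsto> ?q) \<leadsto> (?p \<leadsto> ?q)) = \<one>" using xyz by (simp add: imp_trans)
  then have "(z \<leadsto> ?q) \<leadsto> ?q \<in> F"
    using mp[OF p] xyz one_F by (simp add: imp_swap_absorb)
  then have "(?q \<leadsto> z) \<leadsto> z \<in> F" using wajsberg[of z ?q] xyz by simp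
  then show ?thesis using mp[OF q] xyz by simp
qed

text \<open>Orthogonality of \<open>a\<close> and \<open>b\<close> means that their common upper
  bounds lie in \<open>F\<close>. By residuation \<open>a' \<leadsto> z\<close> bounds
  \<open>a\<close> and \<open>b\<close>, hence lies in \<open>F\<close>; so \<open>z\<close> bounds
  \<open>a'\<close> and \<open>b\<close>.\<close>

lemma orthogonal_mult:
  assumes abc: "a \<in> carrier A" "a' \<in> carrier A" "b \<in> carrier A"
    and o: "\<And>z. \<lbrakk>z \<in> carrier A; a \<preceq> z; b \<preceq> z\<rbrakk> \<Longrightarrow> z \<in> F"
    and o': "\<And>z. \<lbrakk>z \<in> carrier A; a' \<preceq> z; b \<preceq> z\<rbrakk> \<Longrightarrow> z \<in> F"
    and z: "z \<in> carrier A" "a \<otimes> a' \<preceq> z" "b \<preceq> z"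
  shows "z \<in> F"
proof (rule o'[OF z(1) _ z(3)], rule o)
  show "a \<preceq> (a' \<leadsto> z)" using z abc by (simp add: residuation)
  have "z \<preceq> (a' \<leadsto> z)" using z abc by (simp add: imp_weaken one_F)
  then show "b \<preceq> (a' \<leadsto> z)" using fle_trans[OF z(3)] z abc by simp
qed (use z abc in auto)

lemma orthogonal_pow:
  assumes ab: "a \<in> carrier A" "b \<in> carrier A"
    and o: "\<And>z. \<lbrakk>z \<in> carrier A; a \<preceq> z; b \<preceq> z\<rbrakk> \<Longrightarrow> z \<in> F"
    and z: "z \<in> carrier A" "a [^] (n::nat) \<preceq> z" "b \<preceq> z"
  shows "z \<in> F"
  using z
proof (induction n arbitrary: z)
  case 0
  then show ?case by (simp add: one_imp)
next
  case (Suc n)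
  show ?case
  proof (rule orthogonal_mult[of "a [^] n" a b])
    show "w \<in> F" if "w \<in> carrier A" "a [^] n \<preceq> w" "b \<preceq> w" for w
      using Suc.IH that .
    show "a [^] n \<otimes> a \<preceq> z" using Suc.prems by simp
  qed (fact ab Suc.prems o nat_pow_closed[OF ab(1)])+
qed

end

section \<open>Maximal filters and the counting function \<open>L\<close>\<close>

text \<open>Maximality is recorded in the form \<open>archimedean\<close>: adjoining any
  \<open>x\<close> outside \<open>F\<close> reaches \<open>m\<close>.\<close>

locale maximal_hoop_filter = hoop_filter A F for A (structure) and F +
  fixes m
  assumes m_closed [simp]: "m \<in> carrier A"
    and m_least: "x \<in> carrier A \<Longrightarrow> m \<leadsto> x = \<one>"
    and m_notin: "m \<notin> F"
    and archimedean: "\<lbrakk>x \<in> carrier A; x \<notin> F\<rbrakk> \<Longrightarrow> \<exists>n::nat. x [^] n \<preceq> m"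
begin

lemma fle_total:
  assumes "x \<in> carrier A" "y \<in> carrier A"
  shows "x \<preceq> y \<or> y \<preceq> x"
proof (rule ccontr)
  assume "\<not> ?thesis"
  then obtain i j :: nat where ij: "(x \<leadsto> y) [^] i \<preceq> m" "(y \<leadsto> x) [^] j \<preceq> m"
    using archimedean assms by (meson imp_closed)
  \<comment> \<open>The two implications are orthogonal by prelinearity. Orthogonality passes to
    powers in one argument after the other, and \<open>m\<close> is above both powers.\<close>
  have "m \<in> F"
  proof (rule orthogonal_pow[where a = "x \<leadsto> y" and b = "(y \<leadsto> x) [^] j"])
    fix z assume z: "z \<in> carrier A" "(x \<leadsto> y) \<preceq> z" "(y \<leadsto> x) [^] j \<preceq> z"
    show "z \<in> F"
      by (rule orthogonal_pow[where a = "y \<leadsto> x" and b = "x \<leadsto> y"])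
        (use z assms prelinear[OF assms] in simp_all)
  qed (use ij assms in simp_all)
  then show False using m_notin by simp
qed

definition L where "L c x = (LEAST n::nat. c [^] n \<preceq> x)"

context
  fixes c
  assumes c [simp]: "c \<in> carrier A" and cF: "c \<notin> F"
begin

lemma L_prop: assumes "x \<in> carrier A" shows "c [^] L c x \<preceq> x"
proof -
  obtain n :: nat where "c [^] n \<preceq> m" using archimedean[OF c cF] by blast
  then have "c [^] n \<preceq> x"
    using fle_trans[of "c [^] n" m x] m_least one_F assms by simp
  then show ?thesis unfolding L_def by (rule LeastI)
qed

lemma L_le_iff: assumes "x \<in> carrier A" shows "L c x \<le> n \<longleftrightarrow> c [^] n \<preceq> x"
proof
  assume "L c x \<le> n"
  then show "c [^] n \<preceq> x"
    using fle_trans[OF fle_pow_anti L_prop] assms by simp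
qed (simp add: L_def Least_le)

lemma L_anti:
  assumes "x \<preceq> y" "x \<in> carrier A" "y \<in> carrier A" shows "L c y \<le> L c x"
  using fle_trans[OF L_prop assms(1)] assms by (simp add: L_le_iff)

lemma L_one: "L c \<one> = 0"
  using L_le_iff[of \<one> 0] by (simp add: imp_refl one_F)

lemma L_le_m: "x \<in> carrier A \<Longrightarrow> L c x \<le> L c m"
  by (rule L_anti) (auto simp: m_least one_F)

lemma L_m_pos: "0 < L c m"
  using L_le_iff[of m 0] m_notin by (auto simp: one_imp)

text \<open>The power just before \<open>L c x\<close> is not below \<open>x\<close> by minimality,
  so it is above by totality. When \<open>L c x = 0\<close>, truncated subtraction leaves the
  exponent \<open>0\<close> and the power is the unit.\<close>

lemma fle_pow_L_minus_one: assumes "x \<in> carrier A" shows "x \<preceq> c [^] (L c x - 1)"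
proof (cases "L c x")
  case 0
  then show ?thesis using assms by (simp add: imp_one one_F)
next
  case (Suc n)
  then show ?thesis using L_le_iff[OF assms, of n] fle_total[of x "c [^] n"] assms by auto
qed

text \<open>The powers of \<open>c\<close> decrease strictly until they reach \<open>m\<close>.\<close>

lemma pow_fle_pow:
  assumes "c [^] j \<preceq> c [^] i" shows "i \<le> j \<or> L c m \<le> j"
proof (cases "i \<le> j")
  case False
  \<comment> \<open>A single repetition among the powers persists: multiplying by further powers of
    \<open>c\<close> keeps \<open>c [^] j\<close> below all later ones, hence below
    \<open>m\<close>.\<close>
  have step: "c [^] j \<preceq> c [^] Suc j"
    by (rule fle_trans[OF assms fle_pow_anti]) (use False in auto)
  have "c [^] j \<preceq> c [^] (j + k)" for k
  proof (induction k)
    case 0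
    show ?case by (simp add: fle_refl)
  next
    case (Suc k)
    have "c [^] (j + k) \<preceq> c [^] Suc (j + k)"
      using fle_mult_right[OF step, of "c [^] k"] nat_pow_mult[OF c, of j k]
        nat_pow_mult[OF c, of "Suc j" k] by (simp del: nat_pow_Suc)
    then show ?case using fle_trans[OF Suc] by simp
  qed
  moreover have "c [^] (j + L c m) \<preceq> m" using L_le_iff[of m "j + L c m"] by simp
  ultimately have "c [^] j \<preceq> m" using fle_trans[of "c [^] j" "c [^] (j + L c m)" m] by simp
  then show ?thesis by (simp add: L_le_iff)
qed simp

lemma L_imp_lower:
  assumes "x \<in> carrier A" "y \<in> carrier A" shows "L c y \<le> L c x + L c (x \<leadsto> y)"
proof -
  let ?j = "L c (x \<leadsto> y)"
  have "c [^] ?j \<otimes> x \<preceq> y" using L_prop[of "x \<leadsto> y"] assms by (simp add: residuation)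
  moreover have "c [^] (L c x + ?j) \<preceq> c [^] ?j \<otimes> x"
    using fle_mult_right[OF L_prop, of x "c [^] ?j"] assms by (simp add: nat_pow_mult m_comm)
  ultimately show ?thesis using fle_trans assms by (simp add: L_le_iff)
qed

lemma L_mult_upper:
  assumes "x \<in> carrier A" "y \<in> carrier A" shows "L c (x \<otimes> y) \<le> L c x + L c y"
  using fle_mult[OF L_prop L_prop, of x y] assms by (simp add: L_le_iff nat_pow_mult)

text \<open>\<open>d\<close> is the error of the approximation: \<open>1\<close> always works, and \<open>0\<close> does if \<open>c\<close> is a coatom.\<close>

context
  fixes d :: nat
  assumes d: "\<And>x. x \<in> carrier A \<Longrightarrow> x \<preceq> c [^] (L c x - d)"
begin

lemma L_imp_upper:
  assumes "x \<in> carrier A" "y \<in> carrier A" shows "L c (x \<leadsto> y) \<le> L c y - (L c x - d)"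
proof -
  let ?i = "L c x - d" and ?j = "L c y - (L c x - d)"
  have "c [^] ?j \<otimes> x \<preceq> c [^] (?i + ?j)"
    using fle_mult_right[OF d, of x "c [^] ?j"] assms by (simp add: nat_pow_mult m_comm)
  moreover have "L c y \<le> ?i + ?j" by linarith
  then have "c [^] (?i + ?j) \<preceq> y" using L_le_iff[of y "?i + ?j"] assms(2) by blast
  ultimately have "c [^] ?j \<otimes> x \<preceq> y" using fle_trans assms by simp
  then show ?thesis using assms by (simp add: L_le_iff residuation)
qed

text \<open>The cap \<open>L c m\<close> appears because exponents can be compared through powers
  only until these reach \<open>m\<close>.\<close>

lemma L_mult_lower:
  assumes "x \<in> carrier A" "y \<in> carrier A"
  shows "min (L c x - d + (L c y - d)) (L c m) \<le> L c (x \<otimes> y)"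
proof -
  have "c [^] L c (x \<otimes> y) \<preceq> c [^] (L c x - d + (L c y - d))"
    using fle_trans[OF L_prop fle_mult[OF d d], of x y] assms by (simp add: nat_pow_mult)
  then show ?thesis using pow_fle_pow by fastforce
qed

lemma normalized_L_imp:
  assumes "x \<in> carrier A" "y \<in> carrier A"
  shows "\<bar>L c (x \<leadsto> y) / L c m - max 0 (L c y / L c m - L c x / L c m)\<bar> \<le> 2 * real d / L c m"
proof -
  have "\<bar>real (L c (x \<leadsto> y)) - max 0 (real (L c y) - L c x)\<bar> \<le> 2 * real d"
    using L_imp_lower[OF assms] L_imp_upper[OF assms] by linarith
  moreover have "max 0 (L c y / L c m - L c x / L c m) = max 0 (real (L c y) - L c x) / L c m"
    using L_m_pos by (simp add: max_def field_simps)
  ultimately show ?thesis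
    using L_m_pos by (simp add: field_simps flip: diff_divide_distrib)
qed

text \<open>Subadditivity of \<open>L\<close> is exact on one side; on the other each factor
  contributes an error \<open>d\<close>, whence \<open>2 * d\<close>.\<close>

lemma normalized_L_mult:
  assumes "x \<in> carrier A" "y \<in> carrier A"
  shows "\<bar>L c (x \<otimes> y) / L c m - min 1 (L c x / L c m + L c y / L c m)\<bar> \<le> 2 * real d / L c m"
proof -
  have "\<bar>real (L c (x \<otimes> y)) - min (L c m) (real (L c x) + L c y)\<bar> \<le> 2 * real d"
    using L_mult_upper[OF assms] L_mult_lower[OF assms] L_le_m[of "x \<otimes> y"] assms by (simp; linarith)
  moreover have "min 1 (L c x / L c m + L c y / L c m) = min (L c m) (real (L c x) + L c y) / L c m"
    using L_m_pos by (simp add: min_def field_simps)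
  ultimately show ?thesis
    using L_m_pos by (simp add: field_simps flip: diff_divide_distrib)
qed

end
end

section \<open>Making the error vanish\<close>

text \<open>With \<open>n = L c x - 1\<close>, the power \<open>c [^] n\<close> is not below
  \<open>x\<close>, so \<open>c [^] n \<leadsto> x\<close> is outside \<open>F\<close> and hence
  below the coatom \<open>c\<close>. Multiplying by \<open>c [^] n\<close> bounds the meet of
  \<open>c [^] n\<close> and \<open>x\<close>, which is \<open>x\<close>, by the next power.\<close>

lemma coatom_exact:
  assumes c: "c \<in> carrier A" "c \<notin> F"
    and coatom: "\<And>e. \<lbrakk>e \<in> carrier A; e \<notin> F\<rbrakk> \<Longrightarrow> e \<preceq> c"
    and x: "x \<in> carrier A"
  shows "x \<preceq> c [^] L c x"
proof (cases "L c x")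
  case 0
  then show ?thesis using x by (simp add: imp_one one_F)
next
  case (Suc n)
  let ?b = "c [^] n"
  have "\<not> ?b \<preceq> x" using L_le_iff[OF c x, of n] Suc by simp
  then have "?b \<leadsto> x \<preceq> c" using coatom c x by simp
  then have "?b \<otimes> (?b \<leadsto> x) \<preceq> ?b \<otimes> c" using fle_mult[OF fle_refl] c x by simp
  moreover have "x \<preceq> ?b \<otimes> (?b \<leadsto> x)"
    using fle_meet[of x ?b] fle_pow_L_minus_one[OF c x] c x Suc by simp
  ultimately show ?thesis using fle_trans[of x "?b \<otimes> (?b \<leadsto> x)" "?b \<otimes> c"] c x Suc by simp
qed

text \<open>The larger \<open>b\<close> of \<open>e\<close> and \<open>e \<leadsto> c\<close> satisfies \<open>c \<preceq> b \<otimes> b\<close>.\<close>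

lemma no_coatom_step:
  assumes c: "c \<in> carrier A" "c \<notin> F" and e: "e \<in> carrier A" "e \<notin> F" "\<not> e \<preceq> c"
  shows "\<exists>b \<in> carrier A - F. L c m < L b m"
proof (cases "L c m = 1")
  case True
  \<comment> \<open>The squaring argument would use the exponent \<open>0\<close> here; instead
    \<open>e\<close> itself serves, since it is not even below \<open>c\<close>.\<close>
  have "\<not> e \<preceq> m" using fle_trans[of e m c] e c m_least one_F by auto
  then have "\<not> L e m \<le> 1" using L_le_iff[OF e(1,2), of m 1] e by simp
  then show ?thesis using True e by (intro bexI[of _ e]) auto
next
  case False
  let ?g = "e \<leadsto> c"
  have "\<exists>b \<in> carrier A - F. e \<otimes> ?g \<preceq> b \<otimes> b"
    using fle_total[of e ?g] fle_mult[of e ?g ?g ?g] fle_mult[of e e ?g e] fle_refl e c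
    by (metis DiffI imp_closed)
  then obtain b where b: "b \<in> carrier A" "b \<notin> F" "e \<otimes> ?g \<preceq> b \<otimes> b" by blast
  have "c \<preceq> e \<otimes> ?g" using fle_meet[of c e] fle_total[of c e] c e by blast
  then have cb: "c \<preceq> b \<otimes> b" using fle_trans[of c "e \<otimes> ?g"] b c e by simp
  \<comment> \<open>The last exponent whose power of \<open>c\<close> is not below \<open>m\<close>.
    It doubles in passing to \<open>b\<close>, and \<open>2 * ?n \<ge> L c m\<close> as
    \<open>?n \<ge> 1\<close>.\<close>
  let ?n = "L c m - 1"
  have n: "0 < ?n" using False L_m_pos[OF c] by simp
  then have "\<not> L c m \<le> ?n" by linarith
  then have "\<not> c [^] ?n \<preceq> m" using L_le_iff[OF c m_closed, of ?n] by blast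
  moreover have "c [^] ?n \<preceq> b [^] (?n + ?n)"
    using fle_pow_mono[OF cb, of ?n] b c by (simp add: nat_pow_distrib nat_pow_mult)
  ultimately have "\<not> b [^] (?n + ?n) \<preceq> m" using fle_trans b c by (meson m_closed nat_pow_closed)
  then have "\<not> L b m \<le> ?n + ?n" using L_le_iff[OF b(1,2), of m "?n + ?n"] by simp
  then show ?thesis using b n by (intro bexI[of _ b]) auto
qed

lemma L_m_unbounded:
  assumes nc: "\<And>c. \<lbrakk>c \<in> carrier A; c \<notin> F\<rbrakk> \<Longrightarrow> \<exists>e \<in> carrier A - F. \<not> e \<preceq> c"
  shows "\<exists>c \<in> carrier A - F. k < L c m"
proof (induction k)
  case 0
  show ?case using m_notin L_m_pos[of m] by auto
next
  case (Suc k)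
  then obtain c where c: "c \<in> carrier A" "c \<notin> F" "k < L c m" by blast
  obtain e where "e \<in> carrier A" "e \<notin> F" "\<not> e \<preceq> c" using nc[OF c(1,2)] by blast
  then obtain b where "b \<in> carrier A - F" "L c m < L b m"
    using no_coatom_step[OF c(1,2)] by blast
  then show ?case using c(3) by (intro bexI[of _ b]) simp_all
qed

text \<open>Unites two cases: a coatom, repeated constantly with \<open>d = 0\<close>, or elements
  with \<open>k < L (c k) m\<close> and \<open>d = 1\<close>, where the error is at most
  \<open>2 / (k + 1)\<close>.\<close>

lemma approximations:
  "\<exists>c d. (\<forall>k. c k \<in> carrier A - F) \<and>
    (\<forall>k. \<forall>x \<in> carrier A. x \<preceq> c k [^] (L (c k) x - d)) \<and>
    (\<lambda>k::nat. 2 * real d / L (c k) m) \<longlonglongrightarrow> 0"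
proof (cases "\<exists>c \<in> carrier A - F. \<forall>e \<in> carrier A - F. e \<preceq> c")
  case True
  then obtain c where c: "c \<in> carrier A" "c \<notin> F" "\<And>e. \<lbrakk>e \<in> carrier A; e \<notin> F\<rbrakk> \<Longrightarrow> e \<preceq> c" by blast
  show ?thesis
    by (intro exI[of _ "\<lambda>_. c"] exI[of _ 0]) (use c coatom_exact[OF c] in auto)
next
  case False
  then obtain c where c: "\<And>k. c k \<in> carrier A - F" "\<And>k. k < L (c k) m"
    using L_m_unbounded by (metis DiffI)
  have "(\<lambda>k. 2 * real 1 / L (c k) m) \<longlonglongrightarrow> 0"
  proof (rule tendsto_sandwich[OF _ _ tendsto_const])
    show "(\<lambda>k. 2 / real (Suc k)) \<longlonglongrightarrow> 0"
      using LIMSEQ_Suc[OF lim_const_over_n[of 2]] by simp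
    show "\<forall>\<^sub>F k in sequentially. 2 * real 1 / L (c k) m \<le> 2 / real (Suc k)"
    proof (intro always_eventually allI)
      fix k
      have "real (Suc k) \<le> L (c k) m" using c(2)[of k] by linarith
      then show "2 * real 1 / L (c k) m \<le> 2 / real (Suc k)" by (intro frac_le) auto
    qed
  qed auto
  moreover have "x \<preceq> c k [^] (L (c k) x - 1)" if "x \<in> carrier A" for x k
    using fle_pow_L_minus_one[of "c k" x] c(1)[of k] that by simp
  ultimately show ?thesis using c(1) by blast
qed

end

section \<open>Existence of maximal filters\<close>

text \<open>This is the filter generated by \<open>F\<close> and \<open>x\<close>; under modus
  ponens the exponents add.\<close>

lemma (in wajsberg_hoop) hoop_filter_generate:
  assumes F: "hoop_filter A F" and x: "x \<in> carrier A"
  shows "hoop_filter A {z \<in> carrier A. \<exists>n::nat. x [^] n \<leadsto> z \<in> F}" (is "hoop_filter A ?F'")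
proof -
  interpret hoop_filter A F by (rule F)
  show ?thesis
  proof
    show "\<one> \<in> ?F'" using x by (auto simp: imp_one one_F)
    fix y z assume "y \<in> ?F'" "(y \<leadsto> z) \<in> ?F'" and z: "z \<in> carrier A"
    then obtain i j :: nat where ij: "y \<in> carrier A" "x [^] i \<preceq> y" "x [^] j \<preceq> (y \<leadsto> z)" by blast
    have "x [^] (i + j) \<preceq> y \<otimes> (y \<leadsto> z)"
      using fle_mult[OF ij(2,3)] ij(1) x z by (simp add: nat_pow_mult)
    moreover have "y \<otimes> (y \<leadsto> z) \<preceq> z" using mult_fle_left[of z] divisibility[of y z] ij(1) z by simp
    ultimately have "x [^] (i + j) \<preceq> z" using fle_trans ij(1) x z by (meson imp_closed m_closed nat_pow_closed)
    then show "z \<in> ?F'" using z by blast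
  qed auto
qed

lemma (in wajsberg_hoop) exists_maximal_hoop_filter:
  assumes m: "m \<in> carrier A" "m \<noteq> \<one>" and least: "\<And>x. x \<in> carrier A \<Longrightarrow> m \<leadsto> x = \<one>"
  shows "\<exists>F. maximal_hoop_filter A F m"
proof -
  let ?S = "{F. hoop_filter A F \<and> m \<notin> F}"
  have "hoop_filter A {\<one>}" by unfold_locales (auto simp: one_imp)
  then have "?S \<noteq> {}" using m by blast
  moreover have "\<Union>C \<in> ?S" if "C \<noteq> {}" and chain: "subset.chain ?S C" for C
  proof -
    have C: "hoop_filter A X" "m \<notin> X" if "X \<in> C" for X
      using chain that unfolding subset.chain_def by auto
    have "hoop_filter A (\<Union>C)"
    proof
      show "\<Union>C \<subseteq> carrier A" using C(1) hoop_filter.F_sub by blast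
      show "\<one> \<in> \<Union>C" using C(1) hoop_filter.one_F \<open>C \<noteq> {}\<close> by blast
      fix x y assume "x \<in> \<Union>C" "(x \<leadsto> y) \<in> \<Union>C" and y: "y \<in> carrier A"
      then obtain X Y where "X \<in> C" "Y \<in> C" "x \<in> X" "(x \<leadsto> y) \<in> Y" by blast
      moreover from this have "X \<subseteq> Y \<or> Y \<subseteq> X"
        using chain unfolding subset.chain_def by blast
      ultimately obtain Z where "Z \<in> C" "x \<in> Z" "(x \<leadsto> y) \<in> Z" by blast
      then show "y \<in> \<Union>C" using hoop_filter.mp[OF C(1)] y by blast
    qed
    then show ?thesis using C(2) by blast
  qed
  ultimately obtain F where F: "hoop_filter A F" "m \<notin> F"
    and max: "\<And>X. \<lbrakk>hoop_filter A X; m \<notin> X; F \<subseteq> X\<rbrakk> \<Longrightarrow> X = F"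
    using bexE[OF subset_Zorn_nonempty[of ?S]] by (metis (mono_tags, lifting) mem_Collect_eq)
  interpret hoop_filter A F by (rule F)
  \<comment> \<open>The filter generated by \<open>F\<close> and \<open>x\<close> properly extends
    \<open>F\<close>, so by maximality it contains \<open>m\<close>.\<close>
  have "\<exists>n::nat. x [^] n \<leadsto> m \<in> F" if x: "x \<in> carrier A" "x \<notin> F" for x
  proof -
    let ?F' = "{z \<in> carrier A. \<exists>n::nat. x [^] n \<leadsto> z \<in> F}"
    have "x [^] (0::nat) \<leadsto> z \<in> F" if "z \<in> F" for z using that F_sub by (auto simp: one_imp)
    then have "F \<subseteq> ?F'" using F_sub by blast
    moreover have "x [^] (1::nat) \<leadsto> x \<in> F" using x by (simp add: fle_refl)
    then have "x \<in> ?F'" using x by blast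
    ultimately have "m \<in> ?F'" using max[OF hoop_filter_generate[OF F(1) x(1)]] x(2) by blast
    then show ?thesis by blast
  qed
  then show ?thesis using m least F(2)
    by (intro exI[of _ F]) (unfold_locales, auto)
qed

section \<open>The unit interval and its path hoop\<close>

text \<open>The standard Wajsberg hoop on the unit interval, dualised by \<open>t \<mapsto> 1 - t\<close>: the hoop
  order is the reverse of the usual one, so the unit is \<open>0\<close> and the least element is \<open>1\<close>.\<close>

definition unit_hoop :: "real hoop" where
  "unit_hoop = \<lparr>carrier = {0..1}, monoid.mult = (\<lambda>a b. min 1 (a + b)), one = 0, imp = (\<lambda>a b. max 0 (b - a))\<rparr>"

text \<open>Functions live on all of the reals so that hoop equality is equality of functions. The
  condition at \<open>0\<close> excludes the constant function \<open>1\<close>, which is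
  idempotent.\<close>

definition path_hoop :: "(real \<Rightarrow> real) hoop" where
  "path_hoop = \<lparr>carrier = {\<phi>. continuous_on UNIV \<phi> \<and> (\<forall>t. 0 \<le> \<phi> t \<and> \<phi> t \<le> 1) \<and> \<phi> 0 = 0},
     monoid.mult = (\<lambda>\<phi> \<psi> t. min 1 (\<phi> t + \<psi> t)), one = (\<lambda>_. 0), imp = (\<lambda>\<phi> \<psi> t. max 0 (\<psi> t - \<phi> t))\<rparr>"

lemma unit_hoop_simps [simp]:
  "carrier unit_hoop = {0..1}" "\<one>\<^bsub>unit_hoop\<^esub> = 0"
  "a \<otimes>\<^bsub>unit_hoop\<^esub> b = min 1 (a + b)" "(a \<leadsto>\<^bsub>unit_hoop\<^esub> b) = max 0 (b - a)"
  by (simp_all add: unit_hoop_def)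

lemma path_hoop_simps [simp]:
  "carrier path_hoop = {\<phi>. continuous_on UNIV \<phi> \<and> (\<forall>t. 0 \<le> \<phi> t \<and> \<phi> t \<le> 1) \<and> \<phi> 0 = 0}"
  "\<one>\<^bsub>path_hoop\<^esub> = (\<lambda>_. 0)" "\<phi> \<otimes>\<^bsub>path_hoop\<^esub> \<psi> = (\<lambda>t. min 1 (\<phi> t + \<psi> t))"
  "(\<phi> \<leadsto>\<^bsub>path_hoop\<^esub> \<psi>) = (\<lambda>t. max 0 (\<psi> t - \<phi> t))"
  by (simp_all add: path_hoop_def)

lemma wajsberg_unit_hoop: "wajsberg_hoop unit_hoop"
proof (rule wajsberg_hoop.intro)
  show "comm_monoid unit_hoop" by (rule comm_monoidI) (auto simp: min_def)
  show "wajsberg_hoop_axioms unit_hoop"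
    by unfold_locales (auto simp: min_def max_def)
qed

lemma wajsberg_path_hoop: "wajsberg_hoop path_hoop"
proof (rule wajsberg_hoop.intro)
  have bounds: "0 \<le> \<phi> t" "\<phi> t \<le> 1" if "\<phi> \<in> carrier path_hoop" for \<phi> t
    using that by auto
  show "comm_monoid path_hoop"
  proof (rule comm_monoidI)
    show "\<phi> \<otimes>\<^bsub>path_hoop\<^esub> \<psi> \<in> carrier path_hoop"
      if "\<phi> \<in> carrier path_hoop" "\<psi> \<in> carrier path_hoop" for \<phi> \<psi>
      using that bounds[OF that(1)] bounds[OF that(2)]
      by (auto intro!: continuous_intros add_nonneg_nonneg)
    show "\<one>\<^bsub>path_hoop\<^esub> \<otimes>\<^bsub>path_hoop\<^esub> \<phi> = \<phi>" if "\<phi> \<in> carrier path_hoop" for \<phi>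
      using bounds[OF that] by simp
    show "\<phi> \<otimes>\<^bsub>path_hoop\<^esub> \<psi> \<otimes>\<^bsub>path_hoop\<^esub> \<rho> = \<phi> \<otimes>\<^bsub>path_hoop\<^esub> (\<psi> \<otimes>\<^bsub>path_hoop\<^esub> \<rho>)"
      if "\<phi> \<in> carrier path_hoop" "\<psi> \<in> carrier path_hoop" "\<rho> \<in> carrier path_hoop" for \<phi> \<psi> \<rho>
    proof
      fix t
      show "(\<phi> \<otimes>\<^bsub>path_hoop\<^esub> \<psi> \<otimes>\<^bsub>path_hoop\<^esub> \<rho>) t = (\<phi> \<otimes>\<^bsub>path_hoop\<^esub> (\<psi> \<otimes>\<^bsub>path_hoop\<^esub> \<rho>)) t"
        using bounds(1)[OF that(1), of t] bounds(1)[OF that(3), of t] by (simp add: min_def)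
    qed
  qed (auto simp: add.commute)
  show "wajsberg_hoop_axioms path_hoop"
  proof
    fix \<phi> \<psi> assume \<phi>: "\<phi> \<in> carrier path_hoop" and \<psi>: "\<psi> \<in> carrier path_hoop"
    note b = bounds[OF \<phi>] bounds[OF \<psi>]
    show "(\<phi> \<leadsto>\<^bsub>path_hoop\<^esub> \<psi>) \<in> carrier path_hoop"
    proof -
      have "\<psi> t - \<phi> t \<le> 1" for t using b(2)[of t] b(1)[of t] b(4)[of t] by linarith
      then show ?thesis using \<phi> \<psi> by (auto intro!: continuous_intros)
    qed
    show "(\<phi> \<leadsto>\<^bsub>path_hoop\<^esub> \<phi>) = \<one>\<^bsub>path_hoop\<^esub>" by simp
    show "\<phi> \<otimes>\<^bsub>path_hoop\<^esub> (\<phi> \<leadsto>\<^bsub>path_hoop\<^esub> \<psi>) = \<psi> \<otimes>\<^bsub>path_hoop\<^esub> (\<psi> \<leadsto>\<^bsub>path_hoop\<^esub> \<phi>)"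
      by (auto simp: max_def)
    show "((\<phi> \<leadsto>\<^bsub>path_hoop\<^esub> \<psi>) \<leadsto>\<^bsub>path_hoop\<^esub> \<psi>) = ((\<psi> \<leadsto>\<^bsub>path_hoop\<^esub> \<phi>) \<leadsto>\<^bsub>path_hoop\<^esub> \<phi>)"
      using b by (auto simp: max_def)
    fix \<rho> assume \<rho>: "\<rho> \<in> carrier path_hoop"
    show "((\<phi> \<otimes>\<^bsub>path_hoop\<^esub> \<psi>) \<leadsto>\<^bsub>path_hoop\<^esub> \<rho>) = (\<phi> \<leadsto>\<^bsub>path_hoop\<^esub> (\<psi> \<leadsto>\<^bsub>path_hoop\<^esub> \<rho>))"
    proof
      fix t
      show "((\<phi> \<otimes>\<^bsub>path_hoop\<^esub> \<psi>) \<leadsto>\<^bsub>path_hoop\<^esub> \<rho>) t = (\<phi> \<leadsto>\<^bsub>path_hoop\<^esub> (\<psi> \<leadsto>\<^bsub>path_hoop\<^esub> \<rho>)) t"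
        using b(1)[of t] b(3)[of t] bounds(2)[OF \<rho>, of t] by (simp add: min_def max_def)
    qed
  qed
qed

lemma eval_hom: "(\<lambda>\<phi>. \<phi> 1) \<in> hoop_hom path_hoop unit_hoop"
  by (rule hoop_homI) auto

lemma eval_surj: "(\<lambda>\<phi>. \<phi> 1) ` carrier path_hoop = carrier unit_hoop"
proof
  show "carrier unit_hoop \<subseteq> (\<lambda>\<phi>. \<phi> 1) ` carrier path_hoop"
  proof
    fix q assume q: "q \<in> carrier unit_hoop"
    show "q \<in> (\<lambda>\<phi>. \<phi> 1) ` carrier path_hoop"
      \<comment> \<open>The absolute value keeps the ramp nonnegative at negative arguments.\<close>
      by (rule image_eqI[of _ _ "\<lambda>t. min q \<bar>t\<bar>"]) (use q in \<open>auto intro!: continuous_intros\<close>)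
  qed
qed auto

text \<open>Otherwise \<open>\<phi>\<close> attains \<open>1 / 2\<close> between \<open>0\<close>
  and \<open>1\<close>, where its square takes the value \<open>1\<close>.\<close>

lemma path_hoop_idem:
  assumes \<phi>: "\<phi> \<in> carrier path_hoop" and idem: "\<phi> \<otimes>\<^bsub>path_hoop\<^esub> \<phi> = \<phi>"
  shows "\<phi> 1 \<noteq> 1"
proof
  assume "\<phi> 1 = 1"
  moreover have "continuous_on {0..1} \<phi>" using \<phi> continuous_on_subset by auto
  ultimately obtain t where "\<phi> t = 1 / 2" using IVT'[of \<phi> 0 "1 / 2" 1] \<phi> by auto
  then show False using fun_cong[OF idem, of t] by simp
qed

section \<open>The limit homomorphism and the lifting argument\<close>

theorem (in wajsberg_hoop) exists_unit_hoop_hom: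
  assumes m: "m \<in> carrier A" "m \<noteq> \<one>" and least: "\<And>x. x \<in> carrier A \<Longrightarrow> m \<leadsto> x = \<one>"
    and countable: "countable (carrier A)"
  shows "\<exists>f \<in> hoop_hom A unit_hoop. f m = 1"
proof -
  obtain F where "maximal_hoop_filter A F m"
    using exists_maximal_hoop_filter[OF m least] by blast
  then interpret maximal_hoop_filter A F m .
  obtain c :: "nat \<Rightarrow> 'a" and d where c: "\<And>k. c k \<in> carrier A" "\<And>k. c k \<notin> F"
    and d: "\<And>k x. x \<in> carrier A \<Longrightarrow> x \<leadsto> c k [^] (L (c k) x - d) \<in> F"
    and lim: "(\<lambda>k. 2 * real d / L (c k) m) \<longlonglongrightarrow> 0"
    using approximations by blast
  define g where "g k x = L (c k) x / L (c k) m" for k x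
  have g01: "0 \<le> g k x" "g k x \<le> 1" if "x \<in> carrier A" for k x
    using L_le_m[OF c that] L_m_pos[OF c] by (simp_all add: g_def)
  \<comment> \<open>Uniform boundedness and countability of the carrier allow a diagonal choice of
    one subsequence converging at every element.\<close>
  have "norm (g k x) \<le> 1" if "x \<in> carrier A" for k x using g01[OF that] by simp
  then obtain r :: "nat \<Rightarrow> nat" where r: "strict_mono r"
    and conv: "\<And>x. x \<in> carrier A \<Longrightarrow> \<exists>l. (\<lambda>k. g (r k) x) \<longlonglongrightarrow> l"
    using function_convergent_subsequence[OF countable, of g 1] by blast
  define f where "f x = lim (\<lambda>k. g (r k) x)" for x
  have f: "(\<lambda>k. g (r k) x) \<longlonglongrightarrow> f x" if "x \<in> carrier A" for x
    using conv[OF that] unfolding f_def by (metis limI)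
  have lim_r: "(\<lambda>k. 2 * real d / L (c (r k)) m) \<longlonglongrightarrow> 0"
    using LIMSEQ_subseq_LIMSEQ[OF lim r] by (simp add: o_def)
  \<comment> \<open>Identities that hold up to the vanishing error become exact for
    \<open>f\<close>; \<open>h\<close> will be the truncated sum or difference of the
    approximations.\<close>
  have approx: "f z = b" if "z \<in> carrier A" and "h \<longlonglongrightarrow> b"
    and "\<And>k. \<bar>g (r k) z - h k\<bar> \<le> 2 * real d / L (c (r k)) m" for z b and h :: "nat \<Rightarrow> real"
  proof -
    have "(\<lambda>k. g (r k) z - h k) \<longlonglongrightarrow> 0"
      by (rule Lim_null_comparison[OF _ lim_r]) (use that(3) in auto)
    moreover have "(\<lambda>k. g (r k) z - h k) \<longlonglongrightarrow> f z - b" by (intro tendsto_diff f that)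
    ultimately show ?thesis using LIMSEQ_unique by fastforce
  qed
  have "f \<in> hoop_hom A unit_hoop"
  proof (rule hoop_homI)
    fix x y assume x: "x \<in> carrier A" and y: "y \<in> carrier A"
    have *: "\<bar>g (r k) (x \<otimes> y) - min 1 (g (r k) x + g (r k) y)\<bar> \<le> 2 * real d / L (c (r k)) m" for k
      unfolding g_def by (rule normalized_L_mult[OF c d x y])
    show "f (x \<otimes> y) = f x \<otimes>\<^bsub>unit_hoop\<^esub> f y"
      unfolding unit_hoop_simps
      by (rule approx[OF _ _ *])
        (use x y in \<open>auto intro!: tendsto_intros f\<close>)
    have *: "\<bar>g (r k) (x \<leadsto> y) - max 0 (g (r k) y - g (r k) x)\<bar> \<le> 2 * real d / L (c (r k)) m" for k
      unfolding g_def by (rule normalized_L_imp[OF c d x y])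
    show "f (x \<leadsto> y) = (f x \<leadsto>\<^bsub>unit_hoop\<^esub> f y)"
      unfolding unit_hoop_simps
      by (rule approx[OF _ _ *])
        (use x y in \<open>auto intro!: tendsto_intros f\<close>)
  next
    fix x assume x: "x \<in> carrier A"
    have "0 \<le> f x" by (rule LIMSEQ_le_const[OF f[OF x]]) (use g01[OF x] in auto)
    moreover have "f x \<le> 1" by (rule LIMSEQ_le_const2[OF f[OF x]]) (use g01[OF x] in auto)
    ultimately show "f x \<in> carrier unit_hoop" by simp
  next
    show "f \<one> = \<one>\<^bsub>unit_hoop\<^esub>" using L_one[OF c] by (simp add: f_def g_def)
  qed
  moreover have "g k m = 1" for k using L_m_pos[OF c, of k] by (simp add: g_def)
  then have "f m = 1" by (simp add: f_def)
  ultimately show ?thesis by blast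
qed

theorem corollary5p7:
  fixes A :: "('a, 'm) hoop_scheme"
  assumes "wajsberg_hoop A"
    and "finitely_generated_hoop A"
    and "projective_hoop TYPE('b::infinite) TYPE('c::infinite) A"
    and "\<exists>x \<in> carrier A. \<exists>y \<in> carrier A. x \<noteq> y"
  shows "\<not> bounded_hoop A"
proof
  interpret wajsberg_hoop A by (rule assms(1))
  assume "bounded_hoop A"
  then obtain m where m: "m \<in> carrier A" "\<And>x. x \<in> carrier A \<Longrightarrow> m \<leadsto>\<^bsub>A\<^esub> x = \<one>\<^bsub>A\<^esub>"
    unfolding bounded_hoop_def hoop_le_def by blast
  \<comment> \<open>If the least element were the unit, \<open>one_imp\<close> would collapse the
    carrier to one point.\<close>
  have "m \<noteq> \<one>\<^bsub>A\<^esub>" using assms(4) m(2) one_imp by metis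
  moreover have "countable (carrier A)"
    using assms(2) countable_hoop_generate countable_finite unfolding finitely_generated_hoop_def by metis
  ultimately obtain f where f: "f \<in> hoop_hom A unit_hoop" "f m = 1"
    using exists_unit_hoop_hom m by blast
  \<comment> \<open>The test hoops here live in \<open>real\<close> and
    \<open>real \<Rightarrow> real\<close>, so the lifting property is first transferred from the
    types \<open>'b\<close> and \<open>'c\<close>.\<close>
  obtain h where h: "h \<in> hoop_hom A path_hoop" "\<And>x. x \<in> carrier A \<Longrightarrow> f x = h x 1"
    using projective_hoop_universal[OF assms(1-3) wajsberg_unit_hoop wajsberg_path_hoop f(1) eval_hom eval_surj]
    by blast
  have "h m \<otimes>\<^bsub>path_hoop\<^esub> h m = h m"
    using hoop_homD(2)[OF h(1) m(1) m(1)] least_idem[OF m] by metis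
  then have "h m 1 \<noteq> 1" using path_hoop_idem hoop_homD(1)[OF h(1) m(1)] by blast
  then show False using h(2)[OF m(1)] f(2) by simp
qed

end
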